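(* Let $G$ be a group and let $\mathbf X=(X,\mathcal I)$ be an ideal $G$-space. Then for every integer $n\ge 2$ $$\Phi_{\mathbf X}(n)\le \hbar(n)\le\varphi(n+1)\le n!.$$
   Context: A $G$-space is a set $X$ with a left action $(g,x)\mapsto gx$ of a group $G$. A Boolean ideal on $X$ is a non-empty family $\mathcal I$ of subsets of $X$ such that $A\cup B\in\mathcal I$ and $A\cap C\in\mathcal I$ for all $A,B\in\mathcal I$, $C\subset X$. It is trivial if it equals the family of all subsets of $X$, and $G$-invariant if $gA\in\mathcal I$ for all $A\in\mathcal I$, $g\in G$. An ideal $G$-space is a pair $(X,\mathcal I)$ consisting of a $G$-space $X$ and a non-trivial $G$-invariant Boolean ideal $\mathcal I$ on $X$. For $A\subset X$ put $\Delta_{\mathcal I}(A)=\{x\in G: A\cap xA\notin\mathcal I\}\subset G$ (this is non-empty iff $A\notin\mathcal I$). For a non-empty $B\subset G$ put $\mathrm{cov}(B)=\min\{|F|:F\subset G,\ G=FB\}$, and $\mathrm{cov}(\emptyset)=\infty$. For $n\in\mathbb N$, $\Phi_{\mathbf X}(n)=\sup_{\mathcal C}\min_{C\in\mathcal C}\mathrm{cov}(\Delta_{\mathcal I}(C))$, where $\mathcal C$ runs over all families of subsets of $X$ with $|\mathcal C|\le n$ and $\bigcup\mathcal C=X$. Definition of $\varphi$: $\varphi(n)=\max_{0<k<n}\sum_{i=0}^{n-k-1}k^i$ ($k$ an integer), so $\varphi(n+1)=\max_{0<k\le n}\sum_{i=0}^{n-k}k^i$. Definition of $\hbar$: Identify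 $n=\{0,\dots,n-1\}$, let $\omega=\{0,1,2,\dots\}$, and let $\omega^n$ be the set of functions $n\to\omega$ with the pointwise order ($f\le g$ iff $f(i)\le g(i)$ for all $i\in n$). For $i\in n$ let $\chi_i\in\omega^n$ be the characteristic function of $\{i\}$. For subsets $A_0,\dots,A_{n-1}\subset\omega^n$ let $\sum_{j\in n}A_j=\{\sum_{j\in n}a_j: a_j\in A_j \text{ for all } j\in n\}$. Given $h\in\omega^n$, define finite sets $h^{[m]}(i)\subset\omega^n$ for $i\in n$, $m\in\omega$ by $h^{[0]}(i)=\{\chi_i\}$ and $h^{[m+1]}(i)=h^{[m]}(i)\cup\{x-x(i)\chi_i: x\in\sum_{j\in n}h^{[m]}(j),\ x\le h\}$. The function $h$ is called $0$-generating if the zero function belongs to $h^{[m]}(i)$ for some $i\in n$ and $m\in\omega$. Then $\hbar(n)$ is the smallest $c\in\omega$ such that the constant function $h:n\to\{c\}$ is $0$-generating. *)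

theory Defs
  imports "HOL-Algebra.Group_Action" "HOL-Library.Extended_Nat"
begin

definition boolean_ideal :: "'x set \<Rightarrow> 'x set set \<Rightarrow> bool" where
  "boolean_ideal X \<I> \<longleftrightarrow>
     \<I> \<noteq> {} \<and> \<I> \<subseteq> Pow X \<and>
     (\<forall>A\<in>\<I>. \<forall>B\<in>\<I>. A \<union> B \<in> \<I>) \<and>
     (\<forall>A\<in>\<I>. \<forall>C. C \<subseteq> X \<longrightarrow> A \<inter> C \<in> \<I>)"

locale ideal_G_space = group_action G X act
  for G :: "('g, 'm) monoid_scheme" (structure)
    and X :: "'x set"
    and act :: "'g \<Rightarrow> 'x \<Rightarrow> 'x" +
  fixes \<I> :: "'x set set"
  assumes ideal: "boolean_ideal X \<I>"
    and nontrivial: "\<I> \<noteq> Pow X"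
    and invariant: "\<And>A g. A \<in> \<I> \<Longrightarrow> g \<in> carrier G \<Longrightarrow> act g ` A \<in> \<I>"

definition Delta ::
  "('g, 'm) monoid_scheme \<Rightarrow> ('g \<Rightarrow> 'x \<Rightarrow> 'x) \<Rightarrow> 'x set set \<Rightarrow> 'x set \<Rightarrow> 'g set" where
  "Delta G act \<I> A = {g \<in> carrier G. A \<inter> act g ` A \<notin> \<I>}"

text \<open>All infinite cardinals are identified with \<open>\<infinity>\<close>. The infimum of the empty set in
  \<open>enat\<close> is \<open>\<infinity>\<close>, so \<open>cov G B = \<infinity>\<close> when no finite \<open>F\<close> works, in particular for
  empty \<open>B\<close>; otherwise the infimum is attained.\<close>

definition cov :: "('g, 'm) monoid_scheme \<Rightarrow> 'g set \<Rightarrow> enat" where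
  "cov G B =
     (INF F \<in> {F. finite F \<and> F \<subseteq> carrier G \<and> carrier G = F <#>\<^bsub>G\<^esub> B}. enat (card F))"

text \<open>The inner infimum is a minimum: \<open>\<C>\<close> is finite, and it is non-empty because the
  non-triviality of the ideal forces \<open>X\<close> to be non-empty.\<close>

definition Phi ::
  "('g, 'm) monoid_scheme \<Rightarrow> 'x set \<Rightarrow> ('g \<Rightarrow> 'x \<Rightarrow> 'x) \<Rightarrow> 'x set set \<Rightarrow> nat \<Rightarrow> enat" where
  "Phi G X act \<I> n =
     (SUP \<C> \<in> {\<C>. finite \<C> \<and> card \<C> \<le> n \<and> \<C> \<subseteq> Pow X \<and> \<Union>\<C> = X}.
        INF C \<in> \<C>. cov G (Delta G act \<I> C))"

definition phi :: "nat \<Rightarrow> nat" where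
  "phi n = Max ((\<lambda>k. \<Sum>i = 0..n - k - 1. k ^ i) ` {k. 0 < k \<and> k < n})"

text \<open>Elements of \<open>\<omega>\<^sup>n\<close> are represented by functions on \<open>nat\<close> that vanish outside
  \<open>{..<n}\<close>; all members of the sets \<open>gen n h m i\<close> with \<open>i < n\<close> are of this form. Only the
  values of \<open>h\<close> on \<open>{..<n}\<close> matter. The set \<open>gen n h m i\<close> is \<open>h\<^bsup>[m]\<^esup>(i)\<close>.\<close>

definition chi :: "nat \<Rightarrow> nat \<Rightarrow> nat" where
  "chi i = (\<lambda>k. if k = i then 1 else 0)"

definition setsum :: "nat \<Rightarrow> (nat \<Rightarrow> (nat \<Rightarrow> nat) set) \<Rightarrow> (nat \<Rightarrow> nat) set" where
  "setsum n A = {(\<lambda>k. \<Sum>j<n. a j k) | a. \<forall>j<n. a j \<in> A j}"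

primrec gen :: "nat \<Rightarrow> (nat \<Rightarrow> nat) \<Rightarrow> nat \<Rightarrow> nat \<Rightarrow> (nat \<Rightarrow> nat) set" where
  "gen n h 0 = (\<lambda>i. {chi i})"
| "gen n h (Suc m) = (\<lambda>i. gen n h m i \<union>
     {(\<lambda>k. x k - x i * chi i k) | x. x \<in> setsum n (gen n h m) \<and> (\<forall>k<n. x k \<le> h k)})"

definition zero_generating :: "nat \<Rightarrow> (nat \<Rightarrow> nat) \<Rightarrow> bool" where
  "zero_generating n h \<longleftrightarrow> (\<exists>i<n. \<exists>m. (\<lambda>_. 0) \<in> gen n h m i)"

text \<open>The value is \<open>\<infinity>\<close> if no constant function is 0-generating, so a finite upper bound on
  \<open>hbar n\<close> includes the existence of such a constant.\<close>

definition hbar :: "nat \<Rightarrow> enat" where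
  "hbar n = (INF c \<in> {c. zero_generating n (\<lambda>_. c)}. enat c)"

end

theory Submission
  imports Defs
begin

text \<open>
  If \<open>f \<in> h\<^bsup>[m]\<^esup>(i)\<close> and no \<open>\<Delta>(A\<^sub>i)\<close> has covering number at most \<open>c\<close>, then modulo the ideal
  \<open>A\<^sub>i\<close> is covered by \<open>f(k)\<close> translates of each \<open>A\<^sub>k\<close>: adding up gives \<open>X = \<Union>\<^sub>k F\<^sub>k A\<^sub>k\<close> with
  \<open>|F\<^sub>i| \<le> c\<close>, and for \<open>g \<notin> F\<^sub>i \<Delta>(A\<^sub>i)\<close> the translate \<open>g A\<^sub>i\<close> almost avoids \<open>F\<^sub>i A\<^sub>i\<close>. If all other
  \<open>F\<^sub>k\<close> were empty, \<open>A\<^sub>i\<close> and then \<open>X\<close> would lie in the ideal; so \<open>0\<close> is never generated.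

  To generate \<open>0\<close> with \<open>c = \<phi>(n+1)\<close>, consider vectors supported on \<open>k\<close> coordinates that are
  generated, in every placement of the coordinates, at every index outside the support. With
  \<open>q = n - k\<close> indices outside, \<open>w\<close> yields \<open>qw + 1\<close> and one coordinate of this may be deleted.
  Deleting the largest one again and again leads to the staircase \<open>\<tau>\<^sub>q(t) = \<Sum>\<^bsub>i<t\<^esub> q\<^sup>i\<close>, \<open>t < k\<close>. It has
  a zero, so \<open>k\<close> can be lowered by one; iterating in the new dimension gives \<open>\<tau>\<^bsub>q+1\<^esub>\<close>, up to
  \<open>\<tau>\<^bsub>n-1\<^esub> = (0)\<close>.
\<close>

section \<open>Generating the zero function\<close>

text \<open>The push-forward of \<open>w\<close> along \<open>p\<close>. The sum form avoids an
  inverse of \<open>p\<close> and gives 0 off its image.\<close>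

definition place :: "nat \<Rightarrow> (nat \<Rightarrow> nat) \<Rightarrow> (nat \<Rightarrow> nat) \<Rightarrow> nat \<Rightarrow> nat" where
  "place k p w i = (\<Sum>t<k. if p t = i then w t else 0)"

lemma place_image:
  assumes "inj_on p {..<k}" "t < k"
  shows "place k p w (p t) = w t"
proof -
  have "place k p w (p t) = (\<Sum>s<k. if t = s then w s else 0)"
    unfolding place_def using assms by (intro sum.cong refl) (auto simp: inj_on_def)
  then show ?thesis using assms(2) by simp
qed

lemma place_outside: "i \<notin> p ` {..<k} \<Longrightarrow> place k p w i = 0"
  unfolding place_def by (intro sum.neutral) auto

text \<open>Quantifying over all placements makes the order of the entries of \<open>w\<close>
  immaterial, so they can be moved to other indices at will.\<close>

definition available :: "nat \<Rightarrow> nat \<Rightarrow> nat \<Rightarrow> (nat \<Rightarrow> nat) \<Rightarrow> bool" where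
  "available n c k w \<longleftrightarrow>
     (\<forall>p j. inj_on p {..<k} \<longrightarrow> p ` {..<k} \<subseteq> {..<n} \<longrightarrow> j < n \<longrightarrow> j \<notin> p ` {..<k} \<longrightarrow>
        (\<exists>m. place k p w \<in> gen n (\<lambda>_. c) m j))"

lemma available_cong:
  assumes "\<And>t. t < k \<Longrightarrow> w t = w' t"
  shows "available n c k w = available n c k w'"
proof -
  have "place k p w = place k p w'" for p
    unfolding place_def using assms by (intro ext sum.cong) auto
  then show ?thesis by (simp add: available_def)
qed

lemma gen_mono: "m \<le> m' \<Longrightarrow> gen n h m i \<subseteq> gen n h m' i"
  by (induction m' rule: dec_induct) auto

text \<open>One generation step freed from levels: the summands may come from different
  \<open>m\<close>, because by \<open>gen_mono\<close> the sum of these serves as a common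
  level.\<close>

lemma gen_delete:
  assumes a: "\<And>j. j < n \<Longrightarrow> \<exists>m. a j \<in> gen n h m j"
    and le: "\<And>k. k < n \<Longrightarrow> (\<Sum>j<n. a j k) \<le> h k"
  shows "\<exists>m. (\<lambda>k. if k = i then 0 else \<Sum>j<n. a j k) \<in> gen n h m i"
proof -
  obtain M where M: "\<And>j. j < n \<Longrightarrow> a j \<in> gen n h (M j) j" using a by metis
  have "a j \<in> gen n h (\<Sum>j<n. M j) j" if "j < n" for j
  proof -
    have "M j \<le> (\<Sum>j<n. M j)" using that by (intro member_le_sum) auto
    then show ?thesis using M[OF that] gen_mono by blast
  qed
  then have S: "(\<lambda>k. \<Sum>j<n. a j k) \<in> setsum n (gen n h (\<Sum>j<n. M j))"
    unfolding setsum_def by blast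
  have "(\<lambda>k. if k = i then 0 else \<Sum>j<n. a j k) =
      (\<lambda>k. (\<Sum>j<n. a j k) - (\<Sum>j<n. a j i) * chi i k)"
    by (auto simp: chi_def)
  then have "(\<lambda>k. if k = i then 0 else \<Sum>j<n. a j k) \<in> gen n h (Suc (\<Sum>j<n. M j)) i"
    using S le by (auto intro!: exI[of _ "\<lambda>k. \<Sum>j<n. a j k"])
  then show ?thesis by blast
qed

lemma gen_chi: "\<exists>m. chi j \<in> gen n h m j"
  by (intro exI[of _ 0]) simp

text \<open>One round with \<open>q\<close> indices outside the support: every entry
  \<open>v\<close> becomes \<open>q * v + 1\<close> and moves up one place, the last one is deleted,
  and a zero enters in front.\<close>

definition shift_up :: "nat \<Rightarrow> (nat \<Rightarrow> nat) \<Rightarrow> nat \<Rightarrow> nat" where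
  "shift_up q w t = (case t of 0 \<Rightarrow> 0 | Suc s \<Rightarrow> q * w s + 1)"

lemma available_shift_up:
  assumes av: "available n c k w" and n: "n = k + q"
    and le: "\<And>t. t < k \<Longrightarrow> q * w t + 1 \<le> c"
  shows "available n c k (shift_up q w)"
  unfolding available_def
proof (intro allI impI)
  fix p j
  assume p: "inj_on p {..<k}" "p ` {..<k} \<subseteq> {..<n}" and j: "j < n" "j \<notin> p ` {..<k}"
  show "\<exists>m. place k p (shift_up q w) \<in> gen n (\<lambda>_. c) m j"
  proof (cases k)
    case 0
    then show ?thesis using av p j unfolding available_def place_def by auto
  next
    case (Suc l)
    \<comment> \<open>The support \<open>S\<close> of the summands trades \<open>p 0\<close> for
      \<open>j\<close>. Deletion at \<open>j\<close> then kills the last entry, while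
      \<open>p 0\<close>, now outside \<open>S\<close>, gets the value 0.\<close>
    define p' where "p' t = (if t = l then j else p (Suc t))" for t
    define S where "S = p' ` {..<k}"
    have pj: "p (Suc t) \<noteq> j" "p (Suc t) < n" if "t < l" for t
      using that p(2) j(2) Suc by auto
    have pinj: "s = t" if "p (Suc s) = p (Suc t)" "s < l" "t < l" for s t
      using inj_onD[OF p(1) that(1)] that Suc by simp
    have p0: "p 0 \<noteq> p (Suc t)" if "t < l" for t
      using inj_onD[OF p(1), of 0 "Suc t"] that Suc by auto
    have inj': "inj_on p' {..<k}"
      unfolding Suc by (rule inj_onI) (auto simp: p'_def less_Suc_eq pj pj(1)[symmetric] split: if_splits intro: pinj)
    have S: "S \<subseteq> {..<n}" "finite S"
      using pj j(1) Suc by (auto simp: S_def p'_def less_Suc_eq)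
    have card_S: "card S = k" using inj' by (simp add: S_def card_image)
    \<comment> \<open>Each index in \<open>S\<close> adds 1 at itself; each of the \<open>q\<close>
      others adds a copy of \<open>w\<close>.\<close>
    define a where "a i = (if i \<in> S then chi i else place k p' w)" for i
    define x where "x i = (\<Sum>j<n. a j i)" for i
    have a: "\<exists>m. a i \<in> gen n (\<lambda>_. c) m i" if "i < n" for i
      using that av inj' S(1) gen_chi unfolding a_def available_def S_def by auto
    have x: "x i = (if i \<in> S then 1 else 0) + q * place k p' w i" for i
    proof -
      have "x i = (\<Sum>j\<in>S. a j i) + (\<Sum>j\<in>{..<n} - S. a j i)"
        unfolding x_def using sum.subset_diff[OF S(1)] by (simp add: add.commute)
      also have "(\<Sum>j\<in>S. a j i) = (\<Sum>j\<in>S. if i = j then 1 else 0)"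
        by (intro sum.cong) (auto simp: a_def chi_def)
      also have "\<dots> = (if i \<in> S then 1 else 0)" using S(2) by simp
      also have "(\<Sum>j\<in>{..<n} - S. a j i) = q * place k p' w i"
        using S card_S n by (simp add: a_def card_Diff_subset)
      finally show ?thesis .
    qed
    have xS: "x (p' t) = q * w t + 1" if "t < k" for t
      using that x place_image[OF inj' that] by (simp add: S_def)
    have x0: "x i = 0" if "i \<notin> S" for i
      using that x place_outside[of i p' k w] by (simp add: S_def)
    have "x i \<le> c" for i
      using xS le x0 by (cases "i \<in> S") (auto simp: S_def)
    then obtain m where m: "(\<lambda>i. if i = j then 0 else x i) \<in> gen n (\<lambda>_. c) m j"
      using gen_delete[of n a "\<lambda>_. c" j, OF a] unfolding x_def by auto
    have "place k p (shift_up q w) i = (if i = j then 0 else x i)" for i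
    proof (cases "i \<in> p ` {..<k}")
      case True
      then obtain t where t: "t < k" "i = p t" by auto
      have "i \<noteq> j" using True j by auto
      show ?thesis
      proof (cases t)
        case 0
        have "i \<notin> S"
          using t 0 Suc \<open>i \<noteq> j\<close> by (auto simp: S_def p'_def less_Suc_eq dest: p0)
        then show ?thesis using t 0 place_image[OF p(1) t(1)] x0 by (simp add: shift_up_def)
      next
        case (Suc s)
        then have "i = p' s" using t \<open>k = Suc l\<close> by (simp add: p'_def)
        then show ?thesis
          using t Suc place_image[OF p(1) t(1)] xS[of s] \<open>i \<noteq> j\<close> by (simp add: shift_up_def)
      qed
    next
      case False
      then have "i = j \<or> i \<notin> S" using Suc by (auto simp: S_def p'_def less_Suc_eq)
      then show ?thesis using place_outside[OF False] x0 by auto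
    qed
    then have "place k p (shift_up q w) = (\<lambda>i. if i = j then 0 else x i)" by blast
    then show ?thesis using m by auto
  qed
qed

text \<open>The fixed point of \<open>shift_up q\<close>.\<close>

definition stair :: "nat \<Rightarrow> nat \<Rightarrow> nat" where
  "stair q t = (\<Sum>i<t. q ^ i)"

lemma stair_Suc: "stair q (Suc t) = q * stair q t + 1"
  unfolding stair_def by (subst sum.lessThan_Suc_shift) (simp add: sum_distrib_left)

lemma stair_mono: "q \<le> q' \<Longrightarrow> t \<le> t' \<Longrightarrow> stair q t \<le> stair q' t'"
  unfolding stair_def by (rule order_trans[OF sum_mono sum_mono2]) (auto intro: power_mono)

text \<open>After \<open>m\<close> rounds of \<open>shift_up q\<close> the first \<open>m\<close>
  entries agree with the staircase, so \<open>k\<close> rounds suffice. The bound on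
  \<open>w\<close> survives each round and keeps all sums at most
  \<open>stair q (Suc k)\<close>.\<close>

lemma available_stair:
  assumes av: "available n c k w" and n: "n = k + q"
    and le: "\<And>t. t < k \<Longrightarrow> w t \<le> stair q (Suc t)" and c: "stair q (Suc k) \<le> c"
  shows "available n c k (stair q)"
proof -
  have bound: "q * v t + 1 \<le> stair q (Suc (Suc t))" if "v t \<le> stair q (Suc t)" for v t
    using that by (subst stair_Suc) simp
  have "\<exists>v. available n c k v \<and> (\<forall>t<k. v t \<le> stair q (Suc t)) \<and> (\<forall>t<min m k. v t = stair q t)" for m
  proof (induction m)
    case 0
    then show ?case using av le by auto
  next
    case (Suc m)
    then obtain v where v: "available n c k v" "\<And>t. t < k \<Longrightarrow> v t \<le> stair q (Suc t)"
      "\<And>t. t < min m k \<Longrightarrow> v t = stair q t" by blast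
    have "q * v t + 1 \<le> c" if "t < k" for t
      using bound[of v t, OF v(2)[OF that]] stair_mono[of q q "Suc (Suc t)" "Suc k"] that c by linarith
    then have "available n c k (shift_up q v)"
      using available_shift_up[OF v(1) n] by blast
    moreover have "shift_up q v t \<le> stair q (Suc t)" if "t < k" for t
      using that bound[of v, OF v(2)] by (cases t) (auto simp: shift_up_def)
    moreover have "shift_up q v t = stair q t" if "t < min (Suc m) k" for t
      using that v(3) by (cases t) (auto simp: shift_up_def stair_Suc, simp add: stair_def)
    ultimately show ?case by blast
  qed
  from this[of k] obtain v where "available n c k v" "\<And>t. t < k \<Longrightarrow> v t = stair q t" by auto
  then show ?thesis using available_cong by blast
qed

text \<open>As \<open>Suc k < n\<close>, some index \<open>b\<close> is neither \<open>j\<close> nor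
  in the placement; it can carry the zero entry invisibly.\<close>

lemma available_drop_zero:
  assumes av: "available n c (Suc k) w" and w: "w 0 = 0" and n: "Suc k < n"
  shows "available n c k (\<lambda>t. w (Suc t))"
  unfolding available_def
proof (intro allI impI)
  fix p j
  assume p: "inj_on p {..<k}" "p ` {..<k} \<subseteq> {..<n}" and j: "j < n" "j \<notin> p ` {..<k}"
  have "card (insert j (p ` {..<k})) < card {..<n}"
    using p(1) j(2) n by (simp add: card_image)
  then have "\<not> {..<n} \<subseteq> insert j (p ` {..<k})"
    using card_mono[of "insert j (p ` {..<k})" "{..<n}"] by auto
  then obtain b where b: "b < n" "b \<noteq> j" "b \<notin> p ` {..<k}" by blast
  define p' where "p' t = (case t of 0 \<Rightarrow> b | Suc s \<Rightarrow> p s)" for t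
  have im: "p' ` {..<Suc k} = insert b (p ` {..<k})"
    by (auto simp: p'_def lessThan_Suc_eq_insert_0 image_image)
  have "inj_on p' {..<Suc k}"
    using p(1) b(3) by (auto simp: lessThan_Suc_eq_insert_0 p'_def inj_on_def)
  then have "\<exists>m. place (Suc k) p' w \<in> gen n (\<lambda>_. c) m j"
    using av b(1,2) p(2) j unfolding available_def
    by (elim allE[of _ p'] allE[of _ j]) (auto simp: im)
  moreover have "place (Suc k) p' w = place k p (\<lambda>t. w (Suc t))"
    unfolding place_def by (subst sum.lessThan_Suc_shift) (simp add: p'_def w fun_eq_iff)
  ultimately show "\<exists>m. place k p (\<lambda>t. w (Suc t)) \<in> gen n (\<lambda>_. c) m j" by simp
qed

text \<open>Adding all \<open>chi j\<close> gives 1 everywhere below \<open>Suc k\<close>; with only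
  one index outside the support, deleting there leaves exactly the required ones.\<close>

lemma available_ones:
  assumes "1 \<le> c"
  shows "available (Suc k) c k (\<lambda>_. 1)"
  unfolding available_def
proof (intro allI impI)
  fix p j
  assume p: "inj_on p {..<k}" "p ` {..<k} \<subseteq> {..<Suc k}" and j: "j < Suc k" "j \<notin> p ` {..<k}"
  have sum1: "(\<Sum>j<Suc k. chi j i) = (if i < Suc k then 1 else 0)" for i
    unfolding chi_def by (subst sum.delta') auto
  have "insert j (p ` {..<k}) = {..<Suc k}"
    using p j by (intro card_subset_eq) (auto simp: card_image)
  then have im: "i \<in> p ` {..<k} \<longleftrightarrow> i \<noteq> j \<and> i < Suc k" for i using j by auto
  have "\<exists>m. (\<lambda>i. if i = j then 0 else \<Sum>j<Suc k. chi j i) \<in> gen (Suc k) (\<lambda>_. c) m j"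
    using assms by (intro gen_delete gen_chi) (simp only: sum1, simp)
  moreover have "place k p (\<lambda>_. 1) i = (if i = j then 0 else \<Sum>j<Suc k. chi j i)" for i
  proof (cases "i \<in> p ` {..<k}")
    case True
    then obtain t where "t < k" "i = p t" by auto
    then show ?thesis
      using place_image[OF p(1), of t "\<lambda>_. 1"] True im[of i] unfolding sum1 by simp
  next
    case False
    then show ?thesis using place_outside[OF False] im unfolding sum1 by auto
  qed
  ultimately show "\<exists>m. place k p (\<lambda>_. 1) \<in> gen (Suc k) (\<lambda>_. c) m j" by presburger
qed

text \<open>Induction on the number \<open>q\<close> of indices outside the support, from all ones
  at \<open>q = 1\<close> to a single zero entry at \<open>q = n - 1\<close>.\<close>

lemma zero_generating_stair_bound:
  assumes n: "2 \<le> n" and c: "\<And>q. 1 \<le> q \<Longrightarrow> q < n \<Longrightarrow> stair q (Suc (n - q)) \<le> c"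
  shows "zero_generating n (\<lambda>_. c)"
proof -
  have "available n c (n - q) (stair q)" if "1 \<le> q" "q < n" for q
    using that
  proof (induction q rule: nat_induct_at_least)
    case base
    have "1 \<le> stair 1 (Suc (n - 1))" unfolding stair_Suc by simp
    then have "1 \<le> c" using c[of 1] n by linarith
    then have "available n c (n - 1) (\<lambda>_. 1)"
      using available_ones[of c "n - 1"] n by simp
    then show ?case using n c[of 1] by (intro available_stair) (auto simp: stair_Suc)
  next
    case (Suc q)
    \<comment> \<open>Dropping \<open>stair q 0 = 0\<close> shifts the staircase by one;
      monotonicity in \<open>q\<close> then provides the starting bound of
      \<open>available_stair\<close>.\<close>
    have "available n c (n - Suc q) (\<lambda>t. stair q (Suc t))"
      using Suc by (intro available_drop_zero) (auto simp: Suc_diff_Suc stair_def)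
    then show ?case using Suc.prems c[of "Suc q"]
      by (rule_tac available_stair) (auto intro: stair_mono)
  qed
  from this[of "n - 1"] have "available n c 1 (stair (n - 1))" using n by simp
  \<comment> \<open>The one coordinate sits at index 0 and the function is generated at index 1;
    both are below \<open>n\<close> as \<open>2 <= n\<close>.\<close>
  then obtain m where "place 1 (\<lambda>_. 0) (stair (n - 1)) \<in> gen n (\<lambda>_. c) m 1"
    using n unfolding available_def
    by (elim allE[of _ "\<lambda>_. 0"] allE[of _ 1]) (auto simp: inj_on_def)
  moreover have "place 1 (\<lambda>_. 0) (stair (n - 1)) = (\<lambda>_. 0)"
    by (auto simp: place_def stair_def)
  ultimately show ?thesis using n unfolding zero_generating_def by (metis Suc_1 Suc_le_lessD)
qed

section \<open>Bounds on \<open>\<phi>\<close>\<close>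

text \<open>The inclusive range up to \<open>n - k\<close> has \<open>n - k + 1\<close> terms,
  whence the \<open>Suc\<close>.\<close>

lemma phi_stair: "phi (n + 1) = Max ((\<lambda>k. stair k (Suc (n - k))) ` {1..n})"
proof -
  have "{k. 0 < k \<and> k < n + 1} = {1..n}" by auto
  moreover have "(\<Sum>i = 0..n + 1 - k - 1. k ^ i) = stair k (Suc (n - k))" for k
    unfolding stair_def lessThan_Suc_atMost atMost_atLeast0 by simp
  ultimately show ?thesis unfolding phi_def by simp
qed

lemma stair_le_phi: "1 \<le> q \<Longrightarrow> q \<le> n \<Longrightarrow> stair q (Suc (n - q)) \<le> phi (n + 1)"
  unfolding phi_stair by (intro Max_ge) auto

lemma stair_le_fact:
  assumes "1 \<le> k" "k \<le> n"
  shows "stair k (Suc (n - k)) \<le> fact n"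
  using assms(2)
proof (induction n rule: dec_induct)
  case base
  show ?case by (simp add: stair_def)
next
  case (step n)
  have "stair k (Suc (Suc n - k)) = k * stair k (Suc (n - k)) + 1"
    using step by (simp add: Suc_diff_le stair_Suc[of k "Suc (n - k)"])
  \<comment> \<open>Here \<open>k\<close> is at most \<open>n\<close> and 1 is at most
    \<open>fact n\<close>.\<close>
  also have "\<dots> \<le> n * fact n + fact n"
    using step by (intro add_mono mult_mono) auto
  finally show ?case by (simp add: algebra_simps)
qed

lemma phi_le_fact: "1 \<le> n \<Longrightarrow> phi (n + 1) \<le> fact n"
  unfolding phi_stair by (subst Max_le_iff) (auto intro: stair_le_fact[unfolded One_nat_def])

section \<open>Covering numbers in ideal \<open>G\<close>-spaces\<close>

context ideal_G_space
begin

section \<open>Closure properties of the ideal\<close>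

lemma ideal_subset: "A \<in> \<I> \<Longrightarrow> B \<subseteq> A \<Longrightarrow> B \<in> \<I>"
  using ideal unfolding boolean_ideal_def by (metis Int_absorb1 PowD in_mono subset_trans)

lemma ideal_empty: "{} \<in> \<I>"
  using ideal ideal_subset unfolding boolean_ideal_def by blast

lemma ideal_Un: "A \<in> \<I> \<Longrightarrow> B \<in> \<I> \<Longrightarrow> A \<union> B \<in> \<I>"
  using ideal unfolding boolean_ideal_def by blast

lemma ideal_UN: "finite J \<Longrightarrow> (\<And>j. j \<in> J \<Longrightarrow> D j \<in> \<I>) \<Longrightarrow> (\<Union>j\<in>J. D j) \<in> \<I>"
  by (induction J rule: finite_induct) (auto intro: ideal_Un ideal_empty)

lemma space_notin_ideal: "X \<notin> \<I>"
  using ideal ideal_subset nontrivial unfolding boolean_ideal_def by blast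

lemma group_G: "group G"
  using group_hom group_hom.axioms(1) by blast

lemma act_inv_mult_image:
  assumes "g \<in> carrier G" "f \<in> carrier G" "A \<subseteq> X"
  shows "act g ` act (inv g \<otimes> f) ` A = act f ` A"
proof -
  interpret group G by (rule group_G)
  have "act g ` act (inv g \<otimes> f) ` A = act (g \<otimes> (inv g \<otimes> f)) ` A"
    unfolding image_image using assms
    by (intro image_cong refl composition_rule[symmetric]) auto
  moreover have "g \<otimes> (inv g \<otimes> f) = f"
    using assms by (simp add: m_assoc[symmetric])
  ultimately show ?thesis by simp
qed

section \<open>Coverings by translates modulo the ideal\<close>

definition covered :: "nat \<Rightarrow> (nat \<Rightarrow> 'x set) \<Rightarrow> 'x set \<Rightarrow> (nat \<Rightarrow> nat) \<Rightarrow> bool" where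
  "covered n A Y f \<longleftrightarrow>
     (\<exists>F. (\<forall>k<n. finite (F k) \<and> F k \<subseteq> carrier G \<and> card (F k) \<le> f k) \<and>
          Y - (\<Union>k<n. \<Union>g\<in>F k. act g ` A k) \<in> \<I>)"

lemma covered_zero:
  assumes "covered n A Y f" "\<And>k. k < n \<Longrightarrow> f k = 0"
  shows "Y \<in> \<I>"
proof -
  obtain F where F: "\<forall>k<n. finite (F k) \<and> F k \<subseteq> carrier G \<and> card (F k) \<le> f k"
    "Y - (\<Union>k<n. \<Union>g\<in>F k. act g ` A k) \<in> \<I>"
    using assms(1) unfolding covered_def by blast
  have "F k = {}" if "k < n" for k using that assms(2)[OF that] F(1) by auto
  then have "(\<Union>k<n. \<Union>g\<in>F k. act g ` A k) = {}" by blast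
  then show ?thesis using F(2) by (simp only: Diff_empty)
qed

text \<open>The families for the pieces are united. Translates may coincide, which is why
  \<open>covered\<close> bounds cardinalities only from above.\<close>

lemma covered_sum:
  assumes X: "X = (\<Union>i<n. A i)" and a: "\<And>i. i < n \<Longrightarrow> covered n A (A i) (a i)"
  shows "covered n A X (\<lambda>k. \<Sum>i<n. a i k)"
proof -
  have "\<forall>i\<in>{..<n}. \<exists>F. (\<forall>k<n. finite (F k) \<and> F k \<subseteq> carrier G \<and> card (F k) \<le> a i k) \<and>
          A i - (\<Union>k<n. \<Union>g\<in>F k. act g ` A k) \<in> \<I>"
    using a by (simp add: covered_def)
  from bchoice[OF this] obtain F where
    FD: "\<forall>i\<in>{..<n}. (\<forall>k<n. finite (F i k) \<and> F i k \<subseteq> carrier G \<and> card (F i k) \<le> a i k) \<and>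
          A i - (\<Union>k<n. \<Union>g\<in>F i k. act g ` A k) \<in> \<I>" ..
  have F: "finite (F i k) \<and> F i k \<subseteq> carrier G \<and> card (F i k) \<le> a i k"
    if "i < n" "k < n" for i k using FD that by simp
  have D: "A i - (\<Union>k<n. \<Union>g\<in>F i k. act g ` A k) \<in> \<I>" if "i < n" for i
    using FD that by simp
  define H where "H k = (\<Union>i<n. F i k)" for k
  have H: "finite (H k) \<and> H k \<subseteq> carrier G \<and> card (H k) \<le> (\<Sum>i<n. a i k)" if "k < n" for k
  proof -
    have "card (H k) \<le> (\<Sum>i<n. card (F i k))" unfolding H_def by (intro card_UN_le) simp
    also have "\<dots> \<le> (\<Sum>i<n. a i k)" using F that by (intro sum_mono) simp
    finally have "card (H k) \<le> (\<Sum>i<n. a i k)" .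
    moreover have "finite (H k)" using F that by (simp add: H_def)
    moreover have "H k \<subseteq> carrier G" using F that unfolding H_def by blast
    ultimately show ?thesis by simp
  qed
  have sub: "(\<Union>k<n. \<Union>g\<in>F i k. act g ` A k) \<subseteq> (\<Union>k<n. \<Union>g\<in>H k. act g ` A k)"
    if "i < n" for i
    using that by (intro UN_mono) (auto simp: H_def)
  have "(\<Union>i\<in>{..<n}. A i - (\<Union>k<n. \<Union>g\<in>F i k. act g ` A k)) \<in> \<I>"
    by (rule ideal_UN[OF finite_lessThan]) (rule D, simp only: lessThan_iff)
  moreover have "X - (\<Union>k<n. \<Union>g\<in>H k. act g ` A k) \<subseteq>
      (\<Union>i\<in>{..<n}. A i - (\<Union>k<n. \<Union>g\<in>F i k. act g ` A k))"
  proof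
    fix y assume y: "y \<in> X - (\<Union>k<n. \<Union>g\<in>H k. act g ` A k)"
    then obtain i where i: "i < n" "y \<in> A i" unfolding X by blast
    have "y \<in> A i - (\<Union>k<n. \<Union>g\<in>F i k. act g ` A k)"
      using i(2) y sub[OF i(1)] by (meson DiffE DiffI subsetD)
    then show "y \<in> (\<Union>i\<in>{..<n}. A i - (\<Union>k<n. \<Union>g\<in>F i k. act g ` A k))"
      by (rule UN_I[of i, rotated]) (simp add: i(1))
  qed
  ultimately have "X - (\<Union>k<n. \<Union>g\<in>H k. act g ` A k) \<in> \<I>"
    by (rule ideal_subset)
  then show ?thesis unfolding covered_def using H by (intro exI[of _ H]) simp
qed

text \<open>The hypothesis places every \<open>g\<close> in \<open>F\<close> times
  \<open>Delta\<close>. Used contrapositively, to find a \<open>g\<close> outside this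
  product.\<close>

lemma cov_le_card:
  assumes "finite F" "F \<subseteq> carrier G"
    and "\<And>g. g \<in> carrier G \<Longrightarrow> \<exists>f\<in>F. B \<inter> act (inv f \<otimes> g) ` B \<notin> \<I>"
  shows "cov G (Delta G act \<I> B) \<le> enat (card F)"
proof -
  interpret group G by (rule group_G)
  have "carrier G \<subseteq> F <#> Delta G act \<I> B"
  proof
    fix g assume g: "g \<in> carrier G"
    then obtain f where f: "f \<in> F" "B \<inter> act (inv f \<otimes> g) ` B \<notin> \<I>" using assms(3) by blast
    then have "f \<in> carrier G" using assms(2) by blast
    then have "inv f \<otimes> g \<in> Delta G act \<I> B"
      using f(2) g by (simp add: Delta_def)
    moreover have "g = f \<otimes> (inv f \<otimes> g)"
      using g \<open>f \<in> carrier G\<close> by (simp add: m_assoc[symmetric])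
    ultimately show "g \<in> F <#> Delta G act \<I> B" using f(1) unfolding set_mult_def by blast
  qed
  moreover have "F <#> Delta G act \<I> B \<subseteq> carrier G"
    using assms(2) by (auto simp: set_mult_def Delta_def)
  ultimately show ?thesis
    unfolding cov_def using assms by (intro INF_lower) auto
qed

lemma covered_delete:
  assumes X: "covered n A X x" and A: "\<And>k. k < n \<Longrightarrow> A k \<subseteq> X" and i: "i < n" "x i \<le> c"
    and cov: "\<not> cov G (Delta G act \<I> (A i)) \<le> enat c"
  shows "covered n A (A i) (\<lambda>k. if k = i then 0 else x k)"
    and "\<exists>k<n. k \<noteq> i \<and> x k \<noteq> 0"
proof -
  interpret group G by (rule group_G)
  obtain F where F': "\<forall>k<n. finite (F k) \<and> F k \<subseteq> carrier G \<and> card (F k) \<le> x k"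
    and D: "X - (\<Union>k<n. \<Union>g\<in>F k. act g ` A k) \<in> \<I>"
    using X unfolding covered_def by blast
  have F: "finite (F k)" "F k \<subseteq> carrier G" "card (F k) \<le> x k" if "k < n" for k
    using F' that by blast+
  have "\<not> cov G (Delta G act \<I> (A i)) \<le> enat (card (F i))"
    using cov F(3)[OF i(1)] i(2) by (meson enat_ord_simps(1) order_trans)
  then obtain g where g: "g \<in> carrier G"
    and gF: "\<And>f. f \<in> F i \<Longrightarrow> A i \<inter> act (inv f \<otimes> g) ` A i \<in> \<I>"
    using cov_le_card[OF F(1)[OF i(1)] F(2)[OF i(1)]] by blast
  have meet: "act f ` A i \<inter> act g ` A i \<in> \<I>" if "f \<in> F i" for f
  proof -
    have f: "f \<in> carrier G" using that F(2) i by blast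
    have B: "act (inv f \<otimes> g) ` A i \<subseteq> X"
      using surj_prop[of "inv f \<otimes> g"] A[OF i(1)] f g by auto
    \<comment> \<open>Translating the small set by \<open>f\<close> keeps it in the ideal and turns
      \<open>inv f * g\<close> into \<open>g\<close>.\<close>
    have "act f ` (A i \<inter> act (inv f \<otimes> g) ` A i) \<in> \<I>"
      using invariant[OF gF[OF that] f] .
    moreover have "act f ` (A i \<inter> act (inv f \<otimes> g) ` A i) =
        act f ` A i \<inter> act f ` act (inv f \<otimes> g) ` A i"
      by (rule inj_on_image_Int[OF inj_prop[OF f] A[OF i(1)] B])
    ultimately show ?thesis using act_inv_mult_image[OF f g A[OF i(1)]] by simp
  qed
  \<comment> \<open>A point of \<open>R\<close> is missed by all translates, or lies in some
    translate of \<open>A i\<close> by an element of \<open>F i\<close>; both parts are in the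
    ideal.\<close>
  define R where "R = act g ` A i - (\<Union>k\<in>{..<n} - {i}. \<Union>f\<in>F k. act f ` A k)"
  have "R \<in> \<I>"
  proof (rule ideal_subset)
    show "(X - (\<Union>k<n. \<Union>g\<in>F k. act g ` A k)) \<union> (\<Union>f\<in>F i. act f ` A i \<inter> act g ` A i) \<in> \<I>"
      using D F(1) i meet by (intro ideal_Un ideal_UN) auto
    have "act g ` A i \<subseteq> X" using surj_prop[OF g] A[OF i(1)] by auto
    then show "R \<subseteq> (X - (\<Union>k<n. \<Union>g\<in>F k. act g ` A k)) \<union> (\<Union>f\<in>F i. act f ` A i \<inter> act g ` A i)"
      unfolding R_def by blast
  qed
  \<comment> \<open>Pulling back by \<open>inv g\<close> turns the covering of the translate of
    \<open>A i\<close> into one of \<open>A i\<close> itself, with no translates of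
    \<open>A i\<close>.\<close>
  define H where "H k = (if k = i then {} else (\<lambda>f. inv g \<otimes> f) ` F k)" for k
  have "A i - (\<Union>k<n. \<Union>f\<in>H k. act f ` A k) \<subseteq> act (inv g) ` R"
  proof
    fix y assume y: "y \<in> A i - (\<Union>k<n. \<Union>f\<in>H k. act f ` A k)"
    have yX: "y \<in> X" using y A[OF i(1)] by blast
    have "act g y \<notin> act f ` A k" if "k < n" "k \<noteq> i" "f \<in> F k" for k f
    proof
      assume "act g y \<in> act f ` A k"
      then obtain z where z: "z \<in> A k" "act g y = act f z" by auto
      have "f \<in> carrier G" "z \<in> X" using that F(2) A z by blast+
      then have "act (inv g \<otimes> f) z = act (inv g) (act g y)"
        using g z composition_rule by simp
      also have "\<dots> = y" using orbit_sym_aux[OF g yX] by simp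
      finally have "y \<in> act (inv g \<otimes> f) ` A k" using z by force
      then show False using y that by (auto simp: H_def)
    qed
    then have "act g y \<in> R" using y by (auto simp: R_def)
    then show "y \<in> act (inv g) ` R" using orbit_sym_aux[OF g yX refl] by force
  qed
  then have "A i - (\<Union>k<n. \<Union>f\<in>H k. act f ` A k) \<in> \<I>"
    using ideal_subset invariant[OF \<open>R \<in> \<I>\<close>, of "inv g"] g by blast
  moreover have "finite (H k) \<and> H k \<subseteq> carrier G \<and> card (H k) \<le> (if k = i then 0 else x k)"
    if "k < n" for k
    using F(1,2)[OF that] g order_trans[OF card_image_le[OF F(1)[OF that]] F(3)[OF that]]
    by (auto simp: H_def)
  ultimately show cov_i: "covered n A (A i) (\<lambda>k. if k = i then 0 else x k)"
    unfolding covered_def by blast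
  show "\<exists>k<n. k \<noteq> i \<and> x k \<noteq> 0"
  proof (rule ccontr)
    assume "\<not> ?thesis"
    then have x0: "\<And>k. k < n \<Longrightarrow> k \<noteq> i \<Longrightarrow> x k = 0" by blast
    then have "A i \<in> \<I>" using covered_zero[OF cov_i] by auto
    have "F k = {}" if "k < n" "k \<noteq> i" for k
      using x0[OF that] F(1,3)[OF that(1)] by auto
    then have "X - (\<Union>f\<in>F i. act f ` A i) \<subseteq> X - (\<Union>k<n. \<Union>g\<in>F k. act g ` A k)"
      by blast
    moreover have "(\<Union>f\<in>F i. act f ` A i) \<in> \<I>"
      using F(1,2) i \<open>A i \<in> \<I>\<close> invariant by (intro ideal_UN) blast+
    ultimately have "(X - (\<Union>k<n. \<Union>g\<in>F k. act g ` A k)) \<union> (\<Union>f\<in>F i. act f ` A i) \<in> \<I>"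
      "X \<subseteq> (X - (\<Union>k<n. \<Union>g\<in>F k. act g ` A k)) \<union> (\<Union>f\<in>F i. act f ` A i)"
      using D ideal_Un by blast+
    then show False using space_notin_ideal ideal_subset by blast
  qed
qed

text \<open>Induction along \<open>gen\<close>, starting from the identity translate:
  \<open>covered_sum\<close> passes to \<open>X\<close>, and \<open>covered_delete\<close> returns
  to a piece and excludes the zero function.\<close>

lemma covered_gen:
  assumes X: "X = (\<Union>i<n. A i)"
    and cov: "\<And>i. i < n \<Longrightarrow> \<not> cov G (Delta G act \<I> (A i)) \<le> enat c"
  shows "i < n \<Longrightarrow> f \<in> gen n (\<lambda>_. c) m i \<Longrightarrow> covered n A (A i) f \<and> (\<exists>k<n. f k \<noteq> 0)"
proof (induction m arbitrary: i f)
  case 0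
  interpret group G by (rule group_G)
  have f: "f = chi i" using 0 by simp
  have "A i \<subseteq> X" using X 0 by blast
  then have "act \<one> ` A i = A i"
    using id_eq_one[symmetric] by (force simp: subset_iff)
  then have "A i \<subseteq> (\<Union>k<n. \<Union>g\<in>(if k = i then {\<one>} else {}). act g ` A k)"
    using 0 by auto
  then have "A i - (\<Union>k<n. \<Union>g\<in>(if k = i then {\<one>} else {}). act g ` A k) \<in> \<I>"
    using ideal_empty by (simp only: Diff_eq_empty_iff[THEN iffD2])
  then have "covered n A (A i) f"
    unfolding covered_def f chi_def
    by (intro exI[of _ "\<lambda>k. if k = i then {\<one>} else {}"]) simp
  then show ?case using 0 f by (auto simp: chi_def)
next
  case (Suc m)
  show ?case
  proof (cases "f \<in> gen n (\<lambda>_. c) m i")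
    case True
    then show ?thesis using Suc by blast
  next
    case False
    then obtain x where f: "f = (\<lambda>k. x k - x i * chi i k)"
      and x: "x \<in> setsum n (gen n (\<lambda>_. c) m)" "\<And>k. k < n \<Longrightarrow> x k \<le> c"
      using Suc.prems(2) by auto
    obtain a where a: "x = (\<lambda>k. \<Sum>j<n. a j k)" "\<And>j. j < n \<Longrightarrow> a j \<in> gen n (\<lambda>_. c) m j"
      using x(1) unfolding setsum_def by blast
    have f': "f = (\<lambda>k. if k = i then 0 else x k)" unfolding f chi_def by auto
    have "covered n A X x"
      unfolding a(1) using Suc.IH a(2) by (intro covered_sum X) blast
    moreover have "A k \<subseteq> X" if "k < n" for k using X that by blast
    ultimately show ?thesis
      using covered_delete[of n A x i c] Suc.prems(1) x(2) cov unfolding f' by auto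
  qed
qed

lemma Phi_le_zero_generating:
  assumes z: "zero_generating n (\<lambda>_. c)"
  shows "Phi G X act \<I> n \<le> enat c"
  unfolding Phi_def
proof (rule SUP_least)
  fix \<C> assume "\<C> \<in> {\<C>. finite \<C> \<and> card \<C> \<le> n \<and> \<C> \<subseteq> Pow X \<and> \<Union>\<C> = X}"
  then have C: "finite \<C>" "card \<C> \<le> n" "\<Union>\<C> = X" by auto
  \<comment> \<open>An empty family would make \<open>X\<close> empty and hence a member of the
    ideal.\<close>
  have "\<C> \<noteq> {}" using C(3) ideal_empty space_notin_ideal by auto
  obtain B where B: "\<C> = B ` {..<card \<C>}"
    using ex_bij_betw_nat_finite[OF C(1)] by (auto simp: bij_betw_def atLeast0LessThan)
  \<comment> \<open>Families with fewer than \<open>n\<close> members are padded by repeating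
    \<open>B 0\<close>.\<close>
  define A where "A i = (if i < card \<C> then B i else B 0)" for i
  have im: "A ` {..<n} = \<C>"
  proof
    have "B 0 \<in> \<C>" using B \<open>\<C> \<noteq> {}\<close> C(1) by (metis card_gt_0_iff imageI lessThan_iff)
    then show "A ` {..<n} \<subseteq> \<C>" using B by (auto simp: A_def)
    show "\<C> \<subseteq> A ` {..<n}"
    proof
      fix Y assume "Y \<in> \<C>"
      then obtain t where "t < card \<C>" "Y = B t" using B by blast
      then show "Y \<in> A ` {..<n}" using C(2) by (intro image_eqI[of _ _ t]) (auto simp: A_def)
    qed
  qed
  then have X: "X = (\<Union>i<n. A i)" using C(3) by simp
  obtain i m where "i < n" "(\<lambda>_. 0) \<in> gen n (\<lambda>_. c) m i"
    using z unfolding zero_generating_def by blast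
  then obtain k where "k < n" "cov G (Delta G act \<I> (A k)) \<le> enat c"
    using covered_gen[OF X] by blast
  then show "(INF C\<in>\<C>. cov G (Delta G act \<I> C)) \<le> enat c"
    using im by (intro INF_lower2[of "A k"]) auto
qed

end

theorem proposition2p7:
  fixes G :: "('g, 'm) monoid_scheme"
    and X :: "'x set"
    and act :: "'g \<Rightarrow> 'x \<Rightarrow> 'x"
    and \<I> :: "'x set set"
    and n :: nat
  assumes "group G"
    and "ideal_G_space G X act \<I>"
    and "n \<ge> 2"
  shows "Phi G X act \<I> n \<le> hbar n \<and> hbar n \<le> enat (phi (n + 1)) \<and> phi (n + 1) \<le> fact n"
proof (intro conjI)
  show "Phi G X act \<I> n \<le> hbar n"
    unfolding hbar_def using ideal_G_space.Phi_le_zero_generating[OF assms(2)]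
    by (intro INF_greatest) simp
  have "zero_generating n (\<lambda>_. phi (n + 1))"
    using assms(3) by (intro zero_generating_stair_bound stair_le_phi) auto
  then show "hbar n \<le> enat (phi (n + 1))"
    unfolding hbar_def by (intro INF_lower) simp
  show "phi (n + 1) \<le> fact n"
    using assms(3) by (intro phi_le_fact) simp
qed

end
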